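(* Let $g\colon\mathbb{R}^n\to\mathbb{R}\cup\{\infty\}$ be a closed convex function such that for every $y\in\operatorname{dom} g^*$ the problem $$\min_{z\in\mathbb{R}^n}\,[g(z)-y^Tz]$$ has an optimal solution. Let $h\colon\mathbb{R}^n\to\mathbb{R}\cup\{\infty\}$ be a polyhedral convex function. Then the problem $$\min_{x\in\operatorname{dom} g}\,[g(x)-h(x)]$$ has an optimal solution if and only if the following properties hold: (i* ) $\operatorname{dom} h^*\neq\emptyset$; (ii* ) $\operatorname{dom} h^*\subseteq\operatorname{dom} g^*$; (iii* ) $0^+\operatorname{epi} h^*\subseteq 0^+\operatorname{epi} g^*$.
   Context: For an extended-real-valued function $f$ on $\mathbb{R}^n$, $\operatorname{dom} f=\{x\in\mathbb{R}^n\mid f(x)<\infty\}$ and $\operatorname{epi} f=\{(x,r)\in\mathbb{R}^n\times\mathbb{R}\mid r\ge f(x)\}$. A convex function is closed if its epigraph is a closed set, and polyhedral if its epigraph is a convex polyhedron (a finite intersection of closed half-spaces). The conjugate of $f$ is $f^*(y)=\sup_{x\in\mathbb{R}^n}[y^Tx-f(x)]$. The recession cone of a convex set $C$ is $0^+C=\{y\mid C+\{y\}\subseteq C\}$. For $x\in\operatorname{dom} g\setminus\operatorname{dom} h$ one has $g(x)-h(x)=-\infty$. An optimal solution of $\min_{x\in\operatorname{dom} g}[g(x)-h(x)]$ is a point $x^0\in\operatorname{dom} g$ such that $g(x^0)-h(x^0)$ is finite (i.e. $x^0\in\operatorname{dom} g\cap\operatorname{dom} h$) and $g(x^0)-h(x^0)\le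 g(x)-h(x)$ for all $x\in\operatorname{dom} g$. An optimal solution of $\min_{z\in\mathbb{R}^n}[g(z)-y^Tz]$ is a point $z^0\in\operatorname{dom} g$ with $g(z^0)-y^Tz^0\le g(z)-y^Tz$ for all $z\in\mathbb{R}^n$. *)

theory Defs
  imports "HOL-Analysis.Analysis"
begin

text \<open>Functions into \<open>\<real> \<union> {\<infinity>}\<close> are modelled as \<^typ>\<open>ereal\<close>-valued functions; the absence of the
  value \<open>-\<infinity>\<close> is a separate hypothesis, because a conjugate may take it. The library's
  \<open>epigraph\<close> and \<open>convex_on\<close> cover only real-valued functions.\<close>

definition edom :: "('a \<Rightarrow> ereal) \<Rightarrow> 'a set" where
  "edom f = {x. f x < \<infinity>}"

definition epi :: "('a \<Rightarrow> ereal) \<Rightarrow> ('a \<times> real) set" where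
  "epi f = {(x, r). f x \<le> ereal r}"

definition closed_convex_fun :: "('a::euclidean_space \<Rightarrow> ereal) \<Rightarrow> bool" where
  "closed_convex_fun f \<longleftrightarrow> convex (epi f) \<and> closed (epi f)"

text \<open>Convexity of the epigraph is implied here, a polyhedron being an intersection of half-spaces.\<close>

definition polyhedral_convex_fun :: "('a::euclidean_space \<Rightarrow> ereal) \<Rightarrow> bool" where
  "polyhedral_convex_fun f \<longleftrightarrow> polyhedron (epi f)"

definition conjugate :: "('a::euclidean_space \<Rightarrow> ereal) \<Rightarrow> 'a \<Rightarrow> ereal" where
  "conjugate f y = (SUP x. ereal (y \<bullet> x) - f x)"

definition recession_cone :: "'a::euclidean_space set \<Rightarrow> 'a set" where
  "recession_cone C = {y. \<forall>x\<in>C. x + y \<in> C}"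

text \<open>In both problems below the subtraction on \<^typ>\<open>ereal\<close> never meets \<open>\<infinity> - \<infinity>\<close> (which the library
  sets to \<open>\<infinity>\<close>): in the first, \<^term>\<open>g x < \<infinity>\<close> on the feasible set, so that the difference is
  \<open>-\<infinity>\<close> where \<^term>\<open>h x = \<infinity>\<close>; in the second, the subtrahend is real.\<close>

definition dc_optimal_solution ::
    "('a \<Rightarrow> ereal) \<Rightarrow> ('a \<Rightarrow> ereal) \<Rightarrow> 'a \<Rightarrow> bool" where
  "dc_optimal_solution g h x0 \<longleftrightarrow>
     x0 \<in> edom g \<and> \<bar>g x0 - h x0\<bar> \<noteq> \<infinity> \<and> (\<forall>x\<in>edom g. g x0 - h x0 \<le> g x - h x)"

definition tilt_optimal_solution ::
    "('a::euclidean_space \<Rightarrow> ereal) \<Rightarrow> 'a \<Rightarrow> 'a \<Rightarrow> bool" where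
  "tilt_optimal_solution g y z0 \<longleftrightarrow>
     z0 \<in> edom g \<and> (\<forall>z. g z0 - ereal (y \<bullet> z0) \<le> g z - ereal (y \<bullet> z))"

end

theory Submission
  imports Defs
begin

text \<open>Write \<open>h x\<close> as the maximum of finitely many affine functions \<open>a \<bullet> x - c\<close> on the polyhedron
  \<open>dom h\<close> cut out by finitely many inequalities \<open>b \<bullet> x \<le> d\<close>. A vector \<open>(d, \<sigma>)\<close> is in the recession
  cone of \<open>epi f\<^sup>*\<close> iff \<open>d \<bullet> x \<le> \<sigma>\<close> on \<open>dom f\<close>, so (iii*) forces \<open>dom g \<subseteq> dom h\<close>. Then \<open>g - h\<close> is on
  \<open>dom g\<close> the minimum of the finitely many functions \<open>g x - a \<bullet> x + c\<close>, each of which attains its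
  minimum because \<open>a \<in> dom h\<^sup>* \<subseteq> dom g\<^sup>*\<close>. Conversely, an optimal value \<open>\<gamma>\<close> gives \<open>h + \<gamma> \<le> g\<close>, hence
  \<open>dom g \<subseteq> dom h\<close> and \<open>g\<^sup>* \<le> h\<^sup>* - \<gamma>\<close>.\<close>

section \<open>Epigraphs, effective domains and affine minorants\<close>

lemma mem_epi_iff: "(x, r) \<in> epi f \<longleftrightarrow> f x \<le> ereal r"
  by (simp add: epi_def)

lemma mem_edom_iff_epi: "x \<in> edom f \<longleftrightarrow> (\<exists>r. (x, r) \<in> epi f)"
proof (cases "f x")
  case (real r)
  then show ?thesis by (auto simp: edom_def epi_def)
qed (auto simp: edom_def epi_def)

lemma edomI: "(x, r) \<in> epi f \<Longrightarrow> x \<in> edom f"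
  by (auto simp: mem_edom_iff_epi)

lemma edomE:
  assumes "x \<in> edom f" "f x \<noteq> -\<infinity>"
  obtains r where "f x = ereal r"
  using assms by (cases "f x") (auto simp: edom_def)

text \<open>The supremum is bounded termwise, so the points of \<open>epi (conjugate f)\<close> are
  exactly the affine minorants of \<open>f\<close>. All later work with conjugates is done in this
  form.\<close>

lemma mem_epi_conjugate_iff:
  "(y, s) \<in> epi (conjugate f) \<longleftrightarrow> (\<forall>x. ereal (y \<bullet> x - s) \<le> f x)"
proof -
  have "ereal (y \<bullet> x) - f x \<le> ereal s \<longleftrightarrow> ereal (y \<bullet> x - s) \<le> f x" for x
    by (cases "f x") auto
  then show ?thesis
    by (simp add: mem_epi_iff conjugate_def SUP_le_iff)
qed

section \<open>Recession cone of the epigraph of a conjugate\<close>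

lemma le_of_nat_multiples:
  fixes u v s :: real
  assumes "\<And>n::nat. real n * u \<le> s + real n * v"
  shows "u \<le> v"
proof (rule ccontr)
  assume "\<not> u \<le> v"
  then obtain n :: nat where "s < real n * (u - v)"
    using reals_Archimedean3[of "u - v"] by auto
  with assms[of n] show False by (simp add: algebra_simps)
qed

lemma recession_cone_multiple:
  assumes "v \<in> recession_cone C" "p \<in> C"
  shows "p + real n *\<^sub>R v \<in> C"
proof (induction n)
  case (Suc n)
  then have "(p + real n *\<^sub>R v) + v \<in> C"
    using assms(1) by (auto simp: recession_cone_def)
  then show ?case by (simp add: algebra_simps)
qed (use assms in simp)

text \<open>Adding multiples of \<open>(d, s)\<close> to one affine minorant keeps it below the
  finite value \<open>f x\<close>, which bounds the slope \<open>d \<bullet> x - s\<close> by 0.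
  Conversely, adding to a minorant a function that is nonpositive on \<open>edom f\<close> leaves a
  minorant, as \<open>f\<close> is infinite elsewhere.\<close>

lemma mem_recession_cone_epi_conjugate_iff:
  assumes nmin: "\<And>x. f x \<noteq> -\<infinity>" and ne: "edom (conjugate f) \<noteq> {}"
  shows "(d, s) \<in> recession_cone (epi (conjugate f)) \<longleftrightarrow> (\<forall>x\<in>edom f. d \<bullet> x \<le> s)"
proof
  assume rc: "(d, s) \<in> recession_cone (epi (conjugate f))"
  obtain y t where yt: "(y, t) \<in> epi (conjugate f)"
    using ne mem_edom_iff_epi[of _ "conjugate f"] by blast
  show "\<forall>x\<in>edom f. d \<bullet> x \<le> s"
  proof
    fix x assume "x \<in> edom f"
    then obtain r where r: "f x = ereal r" using nmin by (blast elim: edomE)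
    show "d \<bullet> x \<le> s"
    proof (rule le_of_nat_multiples)
      fix n :: nat
      have "(y + real n *\<^sub>R d, t + real n * s) \<in> epi (conjugate f)"
        using recession_cone_multiple[OF rc yt, of n] by simp
      then have "ereal ((y + real n *\<^sub>R d) \<bullet> x - (t + real n * s)) \<le> f x"
        by (simp only: mem_epi_conjugate_iff)
      then show "real n * (d \<bullet> x) \<le> (t + r - y \<bullet> x) + real n * s"
        by (simp add: r inner_add_left)
    qed
  qed
next
  assume le: "\<forall>x\<in>edom f. d \<bullet> x \<le> s"
  have "(y + d, t + s) \<in> epi (conjugate f)" if "(y, t) \<in> epi (conjugate f)" for y t
    unfolding mem_epi_conjugate_iff
  proof
    fix x
    show "ereal ((y + d) \<bullet> x - (t + s)) \<le> f x"
    proof (cases "x \<in> edom f")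
      case True
      then obtain r where "f x = ereal r" using nmin by (blast elim: edomE)
      then show ?thesis
        using that[unfolded mem_epi_conjugate_iff, rule_format, of x] le True
        by (force simp: inner_add_left)
    qed (auto simp: edom_def)
  qed
  then show "(d, s) \<in> recession_cone (epi (conjugate f))"
    by (auto simp: recession_cone_def)
qed

section \<open>Finite representation of a polyhedral function\<close>

lemma polyhedral_convex_fun_representation:
  fixes h :: "'a::euclidean_space \<Rightarrow> ereal"
  assumes nmin: "\<And>x. h x \<noteq> -\<infinity>" and poly: "polyhedral_convex_fun h" and ne: "edom h \<noteq> {}"
  obtains A B :: "('a \<times> real) set" where "finite A" "A \<noteq> {}" "finite B"
    "\<And>x r. (x, r) \<in> epi h \<longleftrightarrow> (\<forall>(a, c)\<in>A. a \<bullet> x - c \<le> r) \<and> (\<forall>(b, d)\<in>B. b \<bullet> x \<le> d)"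
proof -
  obtain x0 r0 where x0: "(x0, r0) \<in> epi h"
    using ne mem_edom_iff_epi[of _ h] by blast
  obtain F where F: "finite F" "epi h = \<Inter>F"
    "\<forall>H\<in>F. \<exists>a b. \<forall>p. p \<in> H \<longleftrightarrow> a \<bullet> p \<le> b"
    using poly unfolding polyhedral_convex_fun_def polyhedron_def by (metis mem_Collect_eq)
  from bchoice[OF F(3)] obtain N where "\<forall>H\<in>F. \<exists>b. \<forall>p. p \<in> H \<longleftrightarrow> N H \<bullet> p \<le> b"
    by blast
  from bchoice[OF this] obtain \<beta> where N: "\<And>H p. H \<in> F \<Longrightarrow> p \<in> H \<longleftrightarrow> N H \<bullet> p \<le> \<beta> H"
    by blast
  define u where "u H = fst (N H)" for H
  define w where "w H = snd (N H)" for H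
  have mem: "(x, r) \<in> H \<longleftrightarrow> u H \<bullet> x + w H * r \<le> \<beta> H" if "H \<in> F" for H x r
    using N[OF that, of "(x, r)"] by (simp add: u_def w_def inner_prod_def)
  \<comment> \<open>The epigraph contains the upward vertical ray from \<open>(x0, r0)\<close>, so
    no half-space may bound \<open>r\<close> from above.\<close>
  have w: "w H \<le> 0" if "H \<in> F" for H
  proof (rule le_of_nat_multiples)
    fix n :: nat
    have "h x0 \<le> ereal r0" using x0 by (simp add: mem_epi_iff)
    then have "h x0 \<le> ereal (r0 + real n)" by (rule order_trans) simp
    then have "(x0, r0 + real n) \<in> H" using F(2) that by (auto simp: mem_epi_iff[symmetric])
    then show "real n * w H \<le> (\<beta> H - u H \<bullet> x0 - w H * r0) + real n * 0"
      using mem[OF that] by (simp add: algebra_simps)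
  qed
  \<comment> \<open>Non-vertical half-spaces are solved for \<open>r\<close> by dividing by
    \<open>- w H > 0\<close> and become affine pieces; vertical ones constrain only \<open>x\<close>
    and describe the domain.\<close>
  define A where "A = (\<lambda>H. (u H /\<^sub>R (- w H), \<beta> H / (- w H))) ` {H\<in>F. w H < 0}"
  define B where "B = (\<lambda>H. (u H, \<beta> H)) ` {H\<in>F. w H = 0}"
  have rep: "(x, r) \<in> epi h \<longleftrightarrow> (\<forall>(a, c)\<in>A. a \<bullet> x - c \<le> r) \<and> (\<forall>(b, d)\<in>B. b \<bullet> x \<le> d)" for x r
  proof -
    have neg: "u H \<bullet> x + w H * r \<le> \<beta> H \<longleftrightarrow> (u H /\<^sub>R (- w H)) \<bullet> x - \<beta> H / (- w H) \<le> r"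
      if "w H < 0" for H
      using that by (simp add: field_simps)
    have "(x, r) \<in> epi h \<longleftrightarrow> (\<forall>H\<in>F. u H \<bullet> x + w H * r \<le> \<beta> H)"
      using F(2) mem by auto
    also have "\<dots> \<longleftrightarrow> (\<forall>H\<in>{H\<in>F. w H < 0}. u H \<bullet> x + w H * r \<le> \<beta> H) \<and>
                     (\<forall>H\<in>{H\<in>F. w H = 0}. u H \<bullet> x \<le> \<beta> H)"
    proof -
      have split: "F = {H\<in>F. w H < 0} \<union> {H\<in>F. w H = 0}"
        using w by (auto simp: le_less)
      show ?thesis by (subst split, subst ball_Un) auto
    qed
    also have "(\<forall>H\<in>{H\<in>F. w H < 0}. u H \<bullet> x + w H * r \<le> \<beta> H) \<longleftrightarrow> (\<forall>(a, c)\<in>A. a \<bullet> x - c \<le> r)"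
      unfolding A_def using neg by (auto simp del: inner_scaleR_left)
    also have "(\<forall>H\<in>{H\<in>F. w H = 0}. u H \<bullet> x \<le> \<beta> H) \<longleftrightarrow> (\<forall>(b, d)\<in>B. b \<bullet> x \<le> d)"
      by (auto simp: B_def)
    finally show ?thesis .
  qed
  \<comment> \<open>Without affine pieces nothing would bound \<open>r\<close> from below over
    \<open>x0\<close>.\<close>
  have "A \<noteq> {}"
  proof
    assume "A = {}"
    then have "(x0, r) \<in> epi h" for r using x0 by (simp add: rep)
    then have "h x0 = -\<infinity>"
      by (intro ereal_bot) (simp add: mem_epi_iff)
    with nmin show False by blast
  qed
  moreover have "finite A" "finite B" using F(1) by (auto simp: A_def B_def)
  ultimately show ?thesis using rep that by blast
qed

section \<open>Necessity and sufficiency of the conditions\<close>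

lemma dc_optimal_imp_minorant:
  assumes opt: "dc_optimal_solution g h x0"
    and g: "\<And>x. g x \<noteq> -\<infinity>" and h: "\<And>x. h x \<noteq> -\<infinity>"
  obtains \<gamma> where "\<And>x. h x + ereal \<gamma> \<le> g x"
proof -
  obtain \<gamma> where \<gamma>: "g x0 - h x0 = ereal \<gamma>"
    using opt by (cases "g x0 - h x0") (auto simp: dc_optimal_solution_def)
  have "h x + ereal \<gamma> \<le> g x" for x
  proof (cases "x \<in> edom g")
    case True
    then obtain r where r: "g x = ereal r" using g by (blast elim: edomE)
    have "ereal \<gamma> \<le> g x - h x"
      using opt True \<gamma> by (auto simp: dc_optimal_solution_def)
    \<comment> \<open>\<open>h x = \<infinity>\<close> is excluded here: the difference would be
      \<open>-\<infinity>\<close>, below the finite optimal value.\<close>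
    then show ?thesis using r h[of x] by (cases "h x") auto
  qed (auto simp: edom_def)
  then show ?thesis by (rule that)
qed

text \<open>Raising an affine minorant of \<open>h\<close> by \<open>\<gamma>\<close> gives one of
  \<open>g\<close>: conjugation reverses the order.\<close>

lemma epi_conjugate_shift:
  assumes "\<And>x. h x + ereal \<gamma> \<le> g x" and "(y, s) \<in> epi (conjugate h)"
  shows "(y, s - \<gamma>) \<in> epi (conjugate g)"
  unfolding mem_epi_conjugate_iff
proof
  fix x
  have "ereal (y \<bullet> x - s) + ereal \<gamma> \<le> h x + ereal \<gamma>"
    using assms(2) by (intro add_right_mono) (simp add: mem_epi_conjugate_iff)
  also have "\<dots> \<le> g x" by (rule assms(1))
  finally show "ereal (y \<bullet> x - (s - \<gamma>)) \<le> g x" by (simp add: algebra_simps)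
qed

text \<open>Each piece is minimised separately at \<open>z p\<close>, and a piece with the least
  value \<open>m p\<close> is chosen. At \<open>z p\<close> another piece may be active, but then
  \<open>h\<close> is only larger, so \<open>g - h\<close> is at most \<open>m p\<close> there; at
  any \<open>x\<close>, the active piece \<open>q\<close> gives the lower bound
  \<open>m q\<close>.\<close>

lemma dc_optimal_solution_exists:
  fixes A :: "('a::euclidean_space \<times> real) set"
  assumes g: "\<And>x. g x \<noteq> -\<infinity>" and h: "\<And>x. h x \<noteq> -\<infinity>"
    and A: "finite A" "A \<noteq> {}"
    and minorant: "\<And>a c x. (a, c) \<in> A \<Longrightarrow> ereal (a \<bullet> x - c) \<le> h x"
    and attained: "\<And>x. x \<in> edom g \<Longrightarrow> \<exists>(a, c)\<in>A. h x = ereal (a \<bullet> x - c)"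
    and tilt: "\<And>a c. (a, c) \<in> A \<Longrightarrow> \<exists>z. tilt_optimal_solution g a z"
  shows "\<exists>x0. dc_optimal_solution g h x0"
proof -
  have "\<forall>p\<in>A. \<exists>z. tilt_optimal_solution g (fst p) z" using tilt by auto
  then obtain z where z: "\<And>p. p \<in> A \<Longrightarrow> tilt_optimal_solution g (fst p) (z p)"
    using bchoice by metis
  define m where "m p = g (z p) - ereal (fst p \<bullet> z p) + ereal (snd p)" for p
  have "Min (m ` A) \<in> m ` A" using A by simp
  then obtain p where p: "p \<in> A" "m p = Min (m ` A)" by force
  then have m_le: "m p \<le> m q" if "q \<in> A" for q using A that by simp
  have zg: "z p \<in> edom g" using z[OF p(1)] by (simp add: tilt_optimal_solution_def)
  obtain r where r: "g (z p) = ereal r" using zg g by (blast elim: edomE)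
  obtain s where s: "h (z p) = ereal s" using attained[OF zg] by auto
  have "g (z p) - h (z p) \<le> g x - h x" if x: "x \<in> edom g" for x
  proof -
    obtain t where t: "g x = ereal t" using x g by (blast elim: edomE)
    obtain q where q: "q \<in> A" "h x = ereal (fst q \<bullet> x - snd q)" using attained[OF x] by auto
    have "fst p \<bullet> z p - snd p \<le> s"
      using minorant[of "fst p" "snd p" "z p"] p(1) s by simp
    then have "g (z p) - h (z p) \<le> m p" by (simp add: m_def r s)
    also have "m p \<le> m q" by (rule m_le) (rule q)
    also have "m q \<le> g x - ereal (fst q \<bullet> x) + ereal (snd q)"
      unfolding m_def using z[OF q(1)]
      by (intro add_right_mono) (simp add: tilt_optimal_solution_def)
    also have "\<dots> = g x - h x" by (simp add: t q(2))
    finally show ?thesis .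
  qed
  then have "dc_optimal_solution g h (z p)"
    using zg r s by (simp add: dc_optimal_solution_def)
  then show ?thesis ..
qed

theorem theorem11:
  fixes g h :: "real ^ 'n \<Rightarrow> ereal"
  assumes "\<And>x. g x \<noteq> -\<infinity>"
    and "closed_convex_fun g"
    and "\<And>y. y \<in> edom (conjugate g) \<Longrightarrow> \<exists>z0. tilt_optimal_solution g y z0"
    and "\<And>x. h x \<noteq> -\<infinity>"
    and "polyhedral_convex_fun h"
  shows "(\<exists>x0. dc_optimal_solution g h x0) \<longleftrightarrow>
           edom (conjugate h) \<noteq> {} \<and>
           edom (conjugate h) \<subseteq> edom (conjugate g) \<and>
           recession_cone (epi (conjugate h)) \<subseteq> recession_cone (epi (conjugate g))"
    (is "?L \<longleftrightarrow> ?R")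
proof
  assume ?L
  then obtain x0 where opt: "dc_optimal_solution g h x0" ..
  obtain \<gamma> where \<gamma>: "\<And>x. h x + ereal \<gamma> \<le> g x"
    using dc_optimal_imp_minorant[OF opt assms(1,4)] by blast
  have dom: "edom g \<subseteq> edom h"
  proof
    fix x assume "x \<in> edom g"
    then show "x \<in> edom h" using \<gamma>[of x] by (cases "h x") (auto simp: edom_def)
  qed
  have "edom h \<noteq> {}" using opt dom by (auto simp: dc_optimal_solution_def)
  then obtain A B where A: "A \<noteq> {}"
    and rep: "\<And>x r. (x, r) \<in> epi h \<longleftrightarrow>
      (\<forall>(a, c)\<in>A. a \<bullet> x - c \<le> r) \<and> (\<forall>(b, d)\<in>B. b \<bullet> x \<le> d)"
    using polyhedral_convex_fun_representation[OF assms(4,5)] by metis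
  obtain a c where ac: "(a, c) \<in> A" using A by auto
  \<comment> \<open>Any piece of the representation is an affine minorant of \<open>h\<close>, hence
    a point of \<open>epi (conjugate h)\<close>.\<close>
  have "ereal (a \<bullet> x - c) \<le> h x" for x
    using rep ac by (intro ereal_le_real[of "h x"]) (auto simp: mem_epi_iff)
  then have "(a, c) \<in> epi (conjugate h)" by (simp add: mem_epi_conjugate_iff)
  then have ne: "edom (conjugate h) \<noteq> {}" by (blast dest: edomI)
  have sub: "edom (conjugate h) \<subseteq> edom (conjugate g)"
    using epi_conjugate_shift[of h \<gamma> g, OF \<gamma>] unfolding mem_edom_iff_epi subset_iff by blast
  with ne have ne': "edom (conjugate g) \<noteq> {}" by blast
  \<comment> \<open>By the inclusion \<open>dom\<close>, an inequality valid on
    \<open>edom h\<close> is valid on \<open>edom g\<close>.\<close>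
  have "recession_cone (epi (conjugate h)) \<subseteq> recession_cone (epi (conjugate g))"
    unfolding subset_iff split_paired_All mem_recession_cone_epi_conjugate_iff[OF assms(1) ne']
      mem_recession_cone_epi_conjugate_iff[OF assms(4) ne]
    using dom by blast
  with ne sub show ?R by blast
next
  assume R: ?R
  then have ne: "edom (conjugate h) \<noteq> {}" "edom (conjugate g) \<noteq> {}" by auto
  have rc: "\<forall>x\<in>edom g. d \<bullet> x \<le> s" if "\<forall>x\<in>edom h. d \<bullet> x \<le> s" for d s
    using R that mem_recession_cone_epi_conjugate_iff[OF assms(1) ne(2)]
      mem_recession_cone_epi_conjugate_iff[OF assms(4) ne(1)] by blast
  have "edom g \<noteq> {}"
    using ne(2) assms(3) by (auto simp: tilt_optimal_solution_def)
  \<comment> \<open>On an empty \<open>edom h\<close> the false inequality \<open>0 \<le> -1\<close>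
    would hold vacuously and transfer to the nonempty \<open>edom g\<close>.\<close>
  then have "edom h \<noteq> {}" using rc[of 0 "-1"] by auto
  then obtain A B where A: "finite A" "A \<noteq> {}"
    and rep: "\<And>x r. (x, r) \<in> epi h \<longleftrightarrow>
      (\<forall>(a, c)\<in>A. a \<bullet> x - c \<le> r) \<and> (\<forall>(b, d)\<in>B. b \<bullet> x \<le> d)"
    using polyhedral_convex_fun_representation[OF assms(4,5)] by metis
  have minorant: "ereal (a \<bullet> x - c) \<le> h x" if "(a, c) \<in> A" for a c x
    using rep that by (intro ereal_le_real[of "h x"]) (auto simp: mem_epi_iff)
  have "\<forall>x\<in>edom h. b \<bullet> x \<le> d" if "(b, d) \<in> B" for b d
    using that by (auto simp: mem_edom_iff_epi rep)
  then have B: "\<forall>(b, d)\<in>B. b \<bullet> x \<le> d" if "x \<in> edom g" for x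
    using rc that by blast
  show ?L
  proof (rule dc_optimal_solution_exists[OF assms(1,4) A minorant])
    fix x assume x: "x \<in> edom g"
    \<comment> \<open>The largest piece at \<open>x\<close> is the value of \<open>h\<close> there:
      the constraints in \<open>B\<close> hold, so \<open>(x, M)\<close> lies in the epigraph, and
      the piece attaining \<open>M\<close> is a minorant.\<close>
    define M where "M = Max ((\<lambda>(a, c). a \<bullet> x - c) ` A)"
    have "M \<in> (\<lambda>(a, c). a \<bullet> x - c) ` A" unfolding M_def using A by (intro Max_in) auto
    then obtain a c where ac: "(a, c) \<in> A" "M = a \<bullet> x - c" by auto
    have "\<forall>p\<in>A. (\<lambda>(a, c). a \<bullet> x - c) p \<le> M" unfolding M_def using A by simp
    then have "(x, M) \<in> epi h" using B[OF x] by (auto simp: rep)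
    then have "h x = ereal (a \<bullet> x - c)"
      using minorant[OF ac(1), of x] ac(2) by (intro antisym) (auto simp: mem_epi_iff)
    with ac(1) show "\<exists>(a, c)\<in>A. h x = ereal (a \<bullet> x - c)" by blast
  next
    fix a c assume "(a, c) \<in> A"
    then have "(a, c) \<in> epi (conjugate h)" by (simp add: mem_epi_conjugate_iff minorant)
    then have "a \<in> edom (conjugate g)" using R by (blast dest: edomI)
    then show "\<exists>z. tilt_optimal_solution g a z" by (rule assms(3))
  qed
qed

end
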